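(* Every perfect open continuous image of a completely regular pseudocompactness-connected space is pseudocompactness-connected. That is, if $X$ is a completely regular space which is $\mathscr{P}$-connected, where $\mathscr{P}$ is pseudocompactness, and $f:X\to Y$ is a perfect open continuous surjection onto a space $Y$, then $Y$ is $\mathscr{P}$-connected.
   Context: Completely regular spaces are taken to be Hausdorff (i.e. Tychonoff). A completely regular space is pseudocompact if every continuous real-valued function on it is bounded. A mapping $f:X\to Y$ is perfect if it is closed and continuous and each fiber $f^{-1}(y)$, $y\in Y$, is a compact subspace of $X$. It is open if images of open sets are open. A zero-set of a space $X$ is a set $f^{-1}(0)$ with $f:X\to[0,1]$ continuous; a cozero-set of $X$ is the complement in $X$ of a zero-set. $\mathrm{Coz}(X)$ denotes the set of all cozero-sets of $X$. Let $\mathscr{P}$ be a topological property. A $\mathscr{P}$-separation for a space $X$ is a pair $C,D\in\mathrm{Coz}(X)$ such that: $C$ and $D$ are disjoint; neither $\mathrm{cl}_XC$ nor $\mathrm{cl}_XD$ has $\mathscr{P}$; and $X\setminus(C\cup D)\subseteq E$ for some $E\in\mathrm{Coz}(X)$ such that $\mathrm{cl}_XE$ has $\mathscr{P}$. The space $X$ is $\mathscr{P}$-disconnected if there is a $\mathscr{P}$-separation for it, and $\mathscr{P}$-connected otherwise. *)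

theory Defs
  imports "HOL-Analysis.Analysis"
begin

text \<open>Completely regular spaces are understood to be Hausdorff, whereas
  \<^const>\<open>completely_regular_space\<close> does not include a separation axiom on points.\<close>

definition tychonoff_space :: "'a topology \<Rightarrow> bool" where
  "tychonoff_space X \<longleftrightarrow> completely_regular_space X \<and> Hausdorff_space X"

definition pseudocompact_space :: "'a topology \<Rightarrow> bool" where
  "pseudocompact_space X \<longleftrightarrow>
     tychonoff_space X \<and>
     (\<forall>f::'a \<Rightarrow> real. continuous_map X euclideanreal f \<longrightarrow> bounded (f ` topspace X))"

definition zero_set_in :: "'a topology \<Rightarrow> 'a set \<Rightarrow> bool" where
  "zero_set_in X Z \<longleftrightarrow>
     (\<exists>f::'a \<Rightarrow> real. continuous_map X (top_of_set {0..1}) f \<and> Z = {x \<in> topspace X. f x = 0})"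

definition Coz :: "'a topology \<Rightarrow> 'a set set" where
  "Coz X = {topspace X - Z | Z. zero_set_in X Z}"

text \<open>A topological property is given as a predicate on topologies; a subset has the property
  if it does so as a subspace.\<close>

definition P_separation ::
    "('a topology \<Rightarrow> bool) \<Rightarrow> 'a topology \<Rightarrow> 'a set \<Rightarrow> 'a set \<Rightarrow> bool" where
  "P_separation P X C D \<longleftrightarrow>
     C \<in> Coz X \<and> D \<in> Coz X \<and> C \<inter> D = {} \<and>
     \<not> P (subtopology X (X closure_of C)) \<and>
     \<not> P (subtopology X (X closure_of D)) \<and>
     (\<exists>E \<in> Coz X. topspace X - (C \<union> D) \<subseteq> E \<and> P (subtopology X (X closure_of E)))"

definition P_disconnected :: "('a topology \<Rightarrow> bool) \<Rightarrow> 'a topology \<Rightarrow> bool" where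
  "P_disconnected P X \<longleftrightarrow> (\<exists>C D. P_separation P X C D)"

definition P_connected :: "('a topology \<Rightarrow> bool) \<Rightarrow> 'a topology \<Rightarrow> bool" where
  "P_connected P X \<longleftrightarrow> \<not> P_disconnected P X"

end

(* Let f be open and perfect. For a continuous real function g on X, the fibrewise maximum of g
   is continuous on Y: its strict superlevel sets are images of open sets, its superlevel sets
   images of closed sets. Hence Y is Tychonoff, and X is pseudocompact whenever Y is, so
   pseudocompactness passes both ways along open perfect maps. As f is open, the preimage of a
   closure is the closure of the preimage, so a separation of Y pulls back to one of X. *)

theory Submission
  imports Defs
begin

section \<open>Fibrewise maxima of continuous real functions\<close>

definition fibre_Sup :: "'a topology \<Rightarrow> ('a \<Rightarrow> 'b) \<Rightarrow> ('a \<Rightarrow> real) \<Rightarrow> 'b \<Rightarrow> real" where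
  "fibre_Sup X f g y = Sup (g ` {x \<in> topspace X. f x = y})"

text \<open>Properness makes the fibre compact and surjectivity makes it nonempty, so the continuous
  image of the fibre has a largest element. Over points of \<open>Y\<close> the \<open>Sup\<close>
  is thus a genuine maximum.\<close>

lemma fibre_Sup_attained:
  assumes f: "perfect_map X Y f" and g: "continuous_map X euclideanreal g"
    and y: "y \<in> topspace Y"
  obtains x where "x \<in> topspace X" "f x = y" "g x = fibre_Sup X f g y"
proof -
  let ?S = "g ` {x \<in> topspace X. f x = y}"
  have "compactin X {x \<in> topspace X. f x = y}"
    using f y by (auto simp: perfect_map_def proper_map_def)
  then have cpt: "compact ?S"
    using g image_compactin compactin_euclidean_iff by blast
  have "y \<in> f ` topspace X"
    using f y by (simp add: perfect_map_def)
  then have "?S \<noteq> {}"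
    by auto
  then obtain s where s: "s \<in> ?S" "\<forall>t \<in> ?S. t \<le> s"
    using compact_attains_sup[OF cpt] by blast
  then have "fibre_Sup X f g y = s"
    unfolding fibre_Sup_def by (intro cSup_eq_maximum) auto
  with s that show thesis
    by auto
qed

lemma fibre_Sup_upper:
  assumes f: "perfect_map X Y f" and g: "continuous_map X euclideanreal g"
    and x: "x \<in> topspace X"
  shows "g x \<le> fibre_Sup X f g (f x)"
proof -
  have "f x \<in> topspace Y"
    using f x by (auto simp: perfect_map_def)
  then have "compactin X {z \<in> topspace X. f z = f x}"
    using f by (auto simp: perfect_map_def proper_map_def)
  then have "compact (g ` {z \<in> topspace X. f z = f x})"
    using g image_compactin compactin_euclidean_iff by blast
  then show ?thesis
    unfolding fibre_Sup_def using x
    by (intro cSup_upper) (auto dest: compact_imp_bounded bounded_imp_bdd_above)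
qed

lemma continuous_map_fibre_Sup:
  assumes f: "perfect_map X Y f" and opn: "open_map X Y f"
    and g: "continuous_map X euclideanreal g"
  shows "continuous_map Y euclideanreal (fibre_Sup X f g)"
proof -
  have f_in: "f x \<in> topspace Y" if "x \<in> topspace X" for x
    using f that by (auto simp: perfect_map_def)
  have gt: "{y \<in> topspace Y. a < fibre_Sup X f g y} = f ` {x \<in> topspace X. a < g x}" for a
  proof (intro equalityI subsetI)
    fix y assume y: "y \<in> {y \<in> topspace Y. a < fibre_Sup X f g y}"
    then obtain x where "x \<in> topspace X" "f x = y" "g x = fibre_Sup X f g y"
      using fibre_Sup_attained[OF f g, of y] by blast
    with y show "y \<in> f ` {x \<in> topspace X. a < g x}"
      by auto
  next
    fix y assume "y \<in> f ` {x \<in> topspace X. a < g x}"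
    then obtain x where x: "x \<in> topspace X" "y = f x" "a < g x"
      by auto
    then have "g x \<le> fibre_Sup X f g y"
      using fibre_Sup_upper[OF f g] by simp
    with x f_in show "y \<in> {y \<in> topspace Y. a < fibre_Sup X f g y}"
      by auto
  qed
  \<comment> \<open>Here attainment is essential: a supremum that is not attained could equal
    \<open>a\<close> although \<open>g\<close> stays below \<open>a\<close> on the whole
    fibre.\<close>
  have ge: "{y \<in> topspace Y. a \<le> fibre_Sup X f g y} = f ` {x \<in> topspace X. a \<le> g x}" for a
  proof (intro equalityI subsetI)
    fix y assume y: "y \<in> {y \<in> topspace Y. a \<le> fibre_Sup X f g y}"
    then obtain x where "x \<in> topspace X" "f x = y" "g x = fibre_Sup X f g y"
      using fibre_Sup_attained[OF f g, of y] by blast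
    with y show "y \<in> f ` {x \<in> topspace X. a \<le> g x}"
      by auto
  next
    fix y assume "y \<in> f ` {x \<in> topspace X. a \<le> g x}"
    then obtain x where x: "x \<in> topspace X" "y = f x" "a \<le> g x"
      by auto
    then have "g x \<le> fibre_Sup X f g y"
      using fibre_Sup_upper[OF f g] by simp
    with x f_in show "y \<in> {y \<in> topspace Y. a \<le> fibre_Sup X f g y}"
      by auto
  qed
  have "openin Y {y \<in> topspace Y. a < fibre_Sup X f g y}" for a
    using opn g unfolding gt open_map_def continuous_map_upper_lower_semicontinuous_lt by blast
  \<comment> \<open>Openness of \<open>f\<close> handled the strict superlevel sets; closedness of
    \<open>f\<close> now makes the sets in \<open>ge\<close> closed, and their complements are the
    strict sublevel sets.\<close>
  moreover have "openin Y {y \<in> topspace Y. fibre_Sup X f g y < a}" for a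
  proof -
    have "closedin Y {y \<in> topspace Y. a \<le> fibre_Sup X f g y}"
      using f g unfolding ge perfect_map_def proper_map_def closed_map_def
        continuous_map_upper_lower_semicontinuous_le by blast
    moreover have "{y \<in> topspace Y. fibre_Sup X f g y < a}
        = topspace Y - {y \<in> topspace Y. a \<le> fibre_Sup X f g y}"
      by auto
    ultimately show ?thesis
      by auto
  qed
  ultimately show ?thesis
    unfolding continuous_map_upper_lower_semicontinuous_lt by blast
qed

section \<open>The Tychonoff property of the image\<close>

lemma completely_regular_space_open_perfect_map_image:
  assumes X: "completely_regular_space X" and f: "perfect_map X Y f" and opn: "open_map X Y f"
  shows "completely_regular_space Y"
  unfolding completely_regular_space_def
proof (intro allI impI)
  fix S y
  assume Sy: "closedin Y S \<and> y \<in> topspace Y - S"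
  then have "y \<in> f ` topspace X"
    using f by (simp add: perfect_map_def)
  then obtain x where x: "x \<in> topspace X" "f x = y"
    by auto
  have "closedin X {x \<in> topspace X. f x \<in> S}"
    using Sy f by (intro closedin_continuous_map_preimage[of X Y]) (auto simp: perfect_map_def)
  moreover have "x \<in> topspace X - {x \<in> topspace X. f x \<in> S}"
    using x Sy by auto
  ultimately obtain g :: "'a \<Rightarrow> real" where g: "continuous_map X (top_of_set {0..1}) g"
    "g x = 0" "g ` {x \<in> topspace X. f x \<in> S} \<subseteq> {1}"
    using X unfolding completely_regular_space_def by meson
  \<comment> \<open>A maximum is large as soon as one fibre point is, and is 0 only if a nonnegative
    function vanishes on the entire fibre. Hence the flip: \<open>?g\<close> is 1 at the single
    chosen point \<open>x\<close> over \<open>y\<close> and 0 on the full preimage of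
    \<open>S\<close>, so \<open>?h\<close> is 1 at \<open>y\<close> and 0 on \<open>S\<close>.
    Taking \<open>1 - ?h\<close> restores the required orientation.\<close>
  let ?g = "\<lambda>x. 1 - g x"
  let ?h = "fibre_Sup X f ?g"
  have gc: "continuous_map X euclideanreal ?g"
    using g(1) by (auto simp: continuous_map_in_subtopology intro!: continuous_intros)
  have g01: "0 \<le> ?g z \<and> ?g z \<le> 1" if "z \<in> topspace X" for z
    using g(1) that by (auto simp: continuous_map_in_subtopology)
  have h01: "0 \<le> ?h z \<and> ?h z \<le> 1" if "z \<in> topspace Y" for z
  proof -
    obtain w where "w \<in> topspace X" "?g w = ?h z"
      using fibre_Sup_attained[OF f gc \<open>z \<in> topspace Y\<close>] by blast
    with g01[of w] show ?thesis
      by simp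
  qed
  have hc: "continuous_map Y (top_of_set {0..1}) (\<lambda>y. 1 - ?h y)"
    using continuous_map_fibre_Sup[OF f opn gc] h01
    by (auto simp: continuous_map_in_subtopology intro!: continuous_intros)
  have "1 \<le> ?h y"
    using fibre_Sup_upper[OF f gc x(1)] x(2) g(2) by simp
  then have hy: "1 - ?h y = 0"
    using h01[of y] Sy by auto
  have hS: "1 - ?h z = 1" if "z \<in> S" for z
  proof -
    have "z \<in> topspace Y"
      using Sy that closedin_subset by blast
    then obtain w where "w \<in> topspace X" "f w = z" "?g w = ?h z"
      using fibre_Sup_attained[OF f gc] by blast
    moreover from this have "g w = 1"
      using g(3) that by auto
    ultimately show ?thesis
      by simp
  qed
  show "\<exists>h::'b \<Rightarrow> real. continuous_map Y (top_of_set {0..1}) h \<and> h y = 0 \<and> h ` S \<subseteq> {1}"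
    using hc hy hS by (intro exI[of _ "\<lambda>y. 1 - ?h y"]) auto
qed

text \<open>The Hausdorff axiom comes indirectly: a closed surjection preserves T1, and a completely
  regular T1 space is regular and hence Hausdorff.\<close>

lemma tychonoff_space_open_perfect_map_image:
  assumes X: "tychonoff_space X" and f: "perfect_map X Y f" and opn: "open_map X Y f"
  shows "tychonoff_space Y"
proof -
  have "completely_regular_space Y"
    using completely_regular_space_open_perfect_map_image X f opn
    by (auto simp: tychonoff_space_def)
  moreover have "t1_space Y"
    using t1_space_closed_map_image[of X Y f] X f Hausdorff_imp_t1_space
    by (auto simp: tychonoff_space_def perfect_map_def proper_map_def)
  ultimately show ?thesis
    using completely_regular_imp_regular_space regular_t1_imp_Hausdorff_space
    by (auto simp: tychonoff_space_def)
qed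

section \<open>Pseudocompactness along open perfect maps\<close>

lemma tychonoff_space_subtopology: "tychonoff_space X \<Longrightarrow> tychonoff_space (subtopology X S)"
  by (simp add: tychonoff_space_def completely_regular_space_subtopology Hausdorff_space_subtopology)

text \<open>By surjectivity \<open>g\<close> and \<open>g \<circ> f\<close> have the same range. The
  Tychonoff assumption on \<open>Y\<close> is there because it is built into
  \<open>pseudocompact_space\<close>.\<close>

lemma pseudocompact_space_continuous_image:
  assumes "pseudocompact_space X" and "continuous_map X Y f" and "f ` topspace X = topspace Y"
    and "tychonoff_space Y"
  shows "pseudocompact_space Y"
  unfolding pseudocompact_space_def
proof (intro conjI allI impI)
  fix g :: "_ \<Rightarrow> real"
  assume "continuous_map Y euclideanreal g"
  then have "continuous_map X euclideanreal (g \<circ> f)"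
    by (rule continuous_map_compose[OF assms(2)])
  then have "bounded ((g \<circ> f) ` topspace X)"
    using assms(1) unfolding pseudocompact_space_def by blast
  then show "bounded (g ` topspace Y)"
    by (simp only: image_comp[symmetric] assms(3))
qed fact

lemma pseudocompact_space_open_perfect_map_preimage:
  assumes Y: "pseudocompact_space Y" and f: "perfect_map X Y f" and opn: "open_map X Y f"
    and X: "tychonoff_space X"
  shows "pseudocompact_space X"
  unfolding pseudocompact_space_def
proof (intro conjI allI impI)
  fix g :: "_ \<Rightarrow> real"
  assume "continuous_map X euclideanreal g"
  \<comment> \<open>The fibrewise maximum bounds a function only from above; passing to the absolute
    value yields a two-sided bound for \<open>g\<close>.\<close>
  then have g: "continuous_map X euclideanreal (\<lambda>x. \<bar>g x\<bar>)"
    by (rule continuous_map_real_abs)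
  have "bounded (fibre_Sup X f (\<lambda>x. \<bar>g x\<bar>) ` topspace Y)"
    using Y continuous_map_fibre_Sup[OF f opn g] by (auto simp: pseudocompact_space_def)
  then obtain B where B: "\<And>y. y \<in> topspace Y \<Longrightarrow> \<bar>fibre_Sup X f (\<lambda>x. \<bar>g x\<bar>) y\<bar> \<le> B"
    by (auto simp: bounded_iff)
  have "\<bar>g x\<bar> \<le> B" if "x \<in> topspace X" for x
  proof -
    have y: "f x \<in> topspace Y"
      using f that by (auto simp: perfect_map_def)
    have "\<bar>g x\<bar> \<le> fibre_Sup X f (\<lambda>x. \<bar>g x\<bar>) (f x)"
      using fibre_Sup_upper[OF f g that] .
    with B[OF y] show ?thesis
      by linarith
  qed
  then show "bounded (g ` topspace X)"
    by (auto simp: bounded_iff)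
qed fact

lemma perfect_map_restriction:
  assumes "perfect_map X Y f" and "{x \<in> topspace X. f x \<in> V} = U"
  shows "perfect_map (subtopology X U) (subtopology Y V) f"
  unfolding perfect_map_def
proof (intro conjI)
  have f: "continuous_map X Y f" "proper_map X Y f" "f ` topspace X = topspace Y"
    using assms(1) by (simp_all add: perfect_map_def)
  show "continuous_map (subtopology X U) (subtopology Y V) f"
    using continuous_map_from_subtopology[OF f(1)] assms(2)
    by (auto simp: continuous_map_in_subtopology)
  show "proper_map (subtopology X U) (subtopology Y V) f"
    using f(2) assms(2) by (rule proper_map_restriction)
  show "f ` topspace (subtopology X U) = topspace (subtopology Y V)"
    unfolding topspace_subtopology f(3)[symmetric] assms(2)[symmetric] by auto
qed

text \<open>Restricted to a full preimage, \<open>f\<close> remains open and perfect onto the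
  subspace given by \<open>V\<close>, so both transfer results apply to the subspaces.\<close>

lemma pseudocompact_subspace_open_perfect_map_preimage_iff:
  assumes X: "tychonoff_space X" and f: "perfect_map X Y f" and opn: "open_map X Y f"
  shows "pseudocompact_space (subtopology X {x \<in> topspace X. f x \<in> V})
    \<longleftrightarrow> pseudocompact_space (subtopology Y V)"
proof -
  let ?U = "{x \<in> topspace X. f x \<in> V}"
  have perf: "perfect_map (subtopology X ?U) (subtopology Y V) f"
    using f by (rule perfect_map_restriction) simp
  moreover from perf have "continuous_map (subtopology X ?U) (subtopology Y V) f"
    "f ` topspace (subtopology X ?U) = topspace (subtopology Y V)"
    by (simp_all only: perfect_map_def)
  moreover have "open_map (subtopology X ?U) (subtopology Y V) f"
    using opn by (rule open_map_restriction) simp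
  moreover have "tychonoff_space (subtopology X ?U)" "tychonoff_space (subtopology Y V)"
    by (intro tychonoff_space_subtopology X tychonoff_space_open_perfect_map_image[OF X f opn])+
  ultimately show ?thesis
    using pseudocompact_space_open_perfect_map_preimage pseudocompact_space_continuous_image
    by blast
qed

section \<open>Pulling back separations\<close>

lemma closure_of_preimage_open_map:
  assumes f: "continuous_map X Y f" and opn: "open_map X Y f"
  shows "X closure_of {x \<in> topspace X. f x \<in> C} = {x \<in> topspace X. f x \<in> Y closure_of C}"
proof (intro equalityI subsetI)
  fix x assume x: "x \<in> X closure_of {x \<in> topspace X. f x \<in> C}"
  then have "f x \<in> Y closure_of (f ` {x \<in> topspace X. f x \<in> C})"
    using continuous_map_image_closure_subset[OF f] by blast
  moreover have "Y closure_of (f ` {x \<in> topspace X. f x \<in> C}) \<subseteq> Y closure_of C"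
    by (intro closure_of_mono) auto
  ultimately show "x \<in> {x \<in> topspace X. f x \<in> Y closure_of C}"
    using x by (auto simp: in_closure_of)
next
  fix x assume x: "x \<in> {x \<in> topspace X. f x \<in> Y closure_of C}"
  show "x \<in> X closure_of {x \<in> topspace X. f x \<in> C}"
    unfolding in_closure_of
  proof (intro conjI allI impI)
    fix T assume T: "x \<in> T \<and> openin X T"
    then have "openin Y (f ` T)" "f x \<in> f ` T"
      using opn by (auto simp: open_map_def)
    then obtain y where "y \<in> C" "y \<in> f ` T"
      using x by (auto simp: in_closure_of)
    then show "\<exists>y. y \<in> {x \<in> topspace X. f x \<in> C} \<and> y \<in> T"
      using T openin_subset by fastforce
  qed (use x in auto)
qed

lemma Coz_preimage:
  assumes f: "continuous_map X Y f" and C: "C \<in> Coz Y"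
  shows "{x \<in> topspace X. f x \<in> C} \<in> Coz X"
proof -
  obtain g :: "_ \<Rightarrow> real" where g: "continuous_map Y (top_of_set {0..1}) g"
    "C = topspace Y - {y \<in> topspace Y. g y = 0}"
    using C by (auto simp: Coz_def zero_set_in_def)
  have "continuous_map X (top_of_set {0..1}) (g \<circ> f)"
    using f g(1) by (rule continuous_map_compose)
  moreover have "{x \<in> topspace X. f x \<in> C} = topspace X - {x \<in> topspace X. (g \<circ> f) x = 0}"
    using g(2) f by (auto simp: continuous_map_def)
  ultimately show ?thesis
    unfolding Coz_def zero_set_in_def by blast
qed

lemma P_separation_preimage_open_perfect_map:
  assumes X: "tychonoff_space X" and f: "perfect_map X Y f" and opn: "open_map X Y f"
    and sep: "P_separation pseudocompact_space Y C D"
  shows "P_separation pseudocompact_space X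
    {x \<in> topspace X. f x \<in> C} {x \<in> topspace X. f x \<in> D}"
proof -
  have cont: "continuous_map X Y f"
    using f by (simp add: perfect_map_def)
  \<comment> \<open>Both directions are used: from \<open>X\<close> to \<open>Y\<close> to see that
    the closures of the preimages of \<open>C\<close> and \<open>D\<close> fail to be pseudocompact,
    from \<open>Y\<close> to \<open>X\<close> for the preimage of \<open>E\<close>.\<close>
  have pc: "pseudocompact_space (subtopology X (X closure_of {x \<in> topspace X. f x \<in> A}))
      \<longleftrightarrow> pseudocompact_space (subtopology Y (Y closure_of A))" for A
    by (simp add: closure_of_preimage_open_map[OF cont opn]
        pseudocompact_subspace_open_perfect_map_preimage_iff[OF X f opn])
  obtain E where E: "E \<in> Coz Y" "topspace Y - (C \<union> D) \<subseteq> E"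
    "pseudocompact_space (subtopology Y (Y closure_of E))"
    using sep by (auto simp: P_separation_def)
  have "topspace X - ({x \<in> topspace X. f x \<in> C} \<union> {x \<in> topspace X. f x \<in> D})
      \<subseteq> {x \<in> topspace X. f x \<in> E}"
    using E(2) cont by (auto simp: continuous_map_def)
  then have "\<exists>E \<in> Coz X. topspace X - ({x \<in> topspace X. f x \<in> C} \<union> {x \<in> topspace X. f x \<in> D}) \<subseteq> E
      \<and> pseudocompact_space (subtopology X (X closure_of E))"
    using Coz_preimage[OF cont E(1)] E(3) pc by blast
  then show ?thesis
    using sep Coz_preimage[OF cont] by (auto simp: P_separation_def pc)
qed

text \<open>Surjectivity, closedness and compactness of fibres are all contained in
  \<open>perfect_map\<close>. The Tychonoff property of \<open>Y\<close> is inherited from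
  \<open>X\<close> through \<open>f\<close>.\<close>

theorem theorem8p5:
  fixes X :: "'a topology" and Y :: "'b topology" and f :: "'a \<Rightarrow> 'b"
  assumes "tychonoff_space X"
    and "P_connected pseudocompact_space X"
    and "perfect_map X Y f"
    and "open_map X Y f"
  shows "P_connected pseudocompact_space Y"
  unfolding P_connected_def P_disconnected_def
proof
  assume "\<exists>C D. P_separation pseudocompact_space Y C D"
  then obtain C D where "P_separation pseudocompact_space Y C D"
    by auto
  then have "P_separation pseudocompact_space X
      {x \<in> topspace X. f x \<in> C} {x \<in> topspace X. f x \<in> D}"
    by (rule P_separation_preimage_open_perfect_map[OF assms(1,3,4)])
  then show False
    using assms(2) unfolding P_connected_def P_disconnected_def by blast
qed

end
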